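(* Let $A$ be a commutative ring, $S=A[x_0,\dots,x_d]$, and $P_{S|A}=S\otimes_AS=A[\boldsymbol{x},\boldsymbol{y}]$ with $x_i=x_i\otimes1$, $y_i=1\otimes x_i$, and $\Delta_{S|A}=(y_0-x_0,\dots,y_d-x_d)$. Let $\Theta:H^{d+1}_{\Delta_{S|A}}(P_{S|A})\to D_{S|A}$ be the $P_{S|A}$-linear isomorphism determined by \[ \Theta\left(\left[\frac{1}{(y_0-x_0)^{a_0+1}\cdots(y_d-x_d)^{a_d+1}}\right]\right)=\partial_{a_0,\dots,a_d}\quad(a_i\ge0). \] Then $\Theta$ is an isomorphism of $D_{S|A}$-modules.
   Context: $D_{S|A}$ is the ring of $A$-linear differential operators on $S$; $\partial_{a_0,\dots,a_d}$ is the $A$-linear map on $S$ with $\partial_{a_0,\dots,a_d}(x_0^{b_0}\cdots x_d^{b_d})=\prod_i\binom{b_i}{a_i}x_0^{b_0-a_0}\cdots x_d^{b_d-a_d}$. $P_{S|A}$ acts on $D_{S|A}$ by $(s_1\otimes s_2)\cdot\delta=\tilde s_1\circ\delta\circ\tilde s_2$ ($\tilde s$ = multiplication by $s$). $D_{S|A}$ acts on itself by left multiplication. $D_{S|A}$ acts on $P_{S|A}=S\otimes_AS$ via $\delta\mapsto\delta\otimes1$ (i.e., on the $\boldsymbol{x}$ variables); this action extends uniquely to localizations (by $\delta(r/z^m)=(\delta(r/z^{m-1})-[\delta,z](r/z^m))/z$), hence to the Čech complex on $y_i-x_i$, giving the $D_{S|A}$-module structure on $H^{d+1}_{\Delta_{S|A}}(P_{S|A})$.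 The classes $[\,\cdot\,]$ are elements of top local cohomology computed by the Čech complex on $y_0-x_0,\dots,y_d-x_d$. *)

theory Defs
  imports "HOL-Library.Poly_Mapping"
begin

(* A :: 'a (commutative ring), variables indexed by a finite type 'n, CARD('n) = d+1.
   S = A[x_i | i::'n] as finitely supported functions monomial => coefficient. *)
type_synonym ('n, 'a) S = "('n \<Rightarrow>\<^sub>0 nat) \<Rightarrow>\<^sub>0 'a"
(* P = S \<otimes>_A S = S[y_i | i::'n] : polynomials in the y-variables with coefficients in S *)
type_synonym ('n, 'a) P = "('n \<Rightarrow>\<^sub>0 nat) \<Rightarrow>\<^sub>0 ('n, 'a) S"

definition Sconst :: "'a::comm_ring_1 \<Rightarrow> ('n, 'a) S" where
  "Sconst c = Poly_Mapping.single 0 c"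

definition Smonom :: "('n \<Rightarrow>\<^sub>0 nat) \<Rightarrow> ('n, 'a::comm_ring_1) S" where
  "Smonom b = Poly_Mapping.single b 1"

definition Xv :: "'n \<Rightarrow> ('n, 'a::comm_ring_1) P" where
  "Xv i = Poly_Mapping.single 0 (Smonom (Poly_Mapping.single i 1))"

definition Yv :: "'n \<Rightarrow> ('n, 'a::comm_ring_1) P" where
  "Yv i = Poly_Mapping.single (Poly_Mapping.single i 1) 1"

definition zv :: "'n \<Rightarrow> ('n, 'a::comm_ring_1) P" where
  "zv i = Yv i - Xv i"

definition zprod :: "('n::finite, 'a::comm_ring_1) P" where
  "zprod = (\<Prod>i\<in>UNIV. zv i)"

definition Alin :: "(('n, 'a::comm_ring_1) S \<Rightarrow> ('n, 'a) S) \<Rightarrow> bool" where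
  "Alin f \<longleftrightarrow> (\<forall>s t. f (s + t) = f s + f t) \<and> (\<forall>c s. f (Sconst c * s) = Sconst c * f s)"

fun diffop :: "nat \<Rightarrow> (('n, 'a::comm_ring_1) S \<Rightarrow> ('n, 'a) S) \<Rightarrow> bool" where
  "diffop 0 f \<longleftrightarrow> Alin f \<and> (\<forall>s t. f (s * t) = s * f t)"
| "diffop (Suc n) f \<longleftrightarrow> Alin f \<and> (\<forall>s. diffop n (\<lambda>t. f (s * t) - s * f t))"

definition Dops :: "(('n, 'a::comm_ring_1) S \<Rightarrow> ('n, 'a) S) set" where
  "Dops = {f. \<exists>n. diffop n f}"

definition dord :: "(('n, 'a::comm_ring_1) S \<Rightarrow> ('n, 'a) S) \<Rightarrow> nat" where
  "dord f = (LEAST n. diffop n f)"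

definition dpart :: "('n::finite \<Rightarrow>\<^sub>0 nat) \<Rightarrow> ('n, 'a::comm_ring_1) S \<Rightarrow> ('n, 'a) S" where
  "dpart a p = (\<Sum>b\<in>Poly_Mapping.keys p.
      if (\<forall>i. Poly_Mapping.lookup a i \<le> Poly_Mapping.lookup b i)
      then Poly_Mapping.single (b - a) ((of_nat (\<Prod>i\<in>UNIV. (Poly_Mapping.lookup b i) choose (Poly_Mapping.lookup a i))) * (Poly_Mapping.lookup p b))
      else 0)"

(* P-action on D: (s1 \<otimes> s2)\<cdot>\<delta> = s1 \<circ> \<delta> \<circ> s2; for p = \<Sum>_\<beta> p_\<beta> y^\<beta> this is \<Sum> p_\<beta> \<circ> \<delta> \<circ> x^\<beta> *)
definition pact :: "('n, 'a::comm_ring_1) P \<Rightarrow> (('n, 'a) S \<Rightarrow> ('n, 'a) S) \<Rightarrow> (('n, 'a) S \<Rightarrow> ('n, 'a) S)" where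
  "pact p f = (\<lambda>s. \<Sum>\<beta>\<in>Poly_Mapping.keys p. Poly_Mapping.lookup p \<beta> * f (Smonom \<beta> * s))"

(* \<delta> \<otimes> 1 acting on P (on the x variables, i.e. coefficientwise) *)
definition liftop :: "(('n, 'a::comm_ring_1) S \<Rightarrow> ('n, 'a) S) \<Rightarrow> ('n, 'a) P \<Rightarrow> ('n, 'a) P" where
  "liftop f p = Poly_Mapping.map f p"

(* fractions r / z^m in the localization P_z, represented as pairs (r, m) *)
definition fsub :: "('n::finite, 'a::comm_ring_1) P \<times> nat \<Rightarrow> ('n, 'a) P \<times> nat \<Rightarrow> ('n, 'a) P \<times> nat" where
  "fsub u v = (fst u * zprod ^ snd v - fst v * zprod ^ snd u, snd u + snd v)"

definition fdivz :: "('n::finite, 'a::comm_ring_1) P \<times> nat \<Rightarrow> ('n, 'a) P \<times> nat" where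
  "fdivz u = (fst u, Suc (snd u))"

definition commz :: "(('n::finite, 'a::comm_ring_1) P \<Rightarrow> ('n, 'a) P) \<Rightarrow> ('n, 'a) P \<Rightarrow> ('n, 'a) P" where
  "commz E = (\<lambda>p. E (zprod * p) - zprod * E p)"

(* extension of an operator E of order < fuel to P_z via
   E(r/z^m) = (E(r/z^(m-1)) - [E,z](r/z^m)) / z ; operators of order < 0 are 0 *)
fun extz :: "nat \<Rightarrow> (('n::finite, 'a::comm_ring_1) P \<Rightarrow> ('n, 'a) P) \<Rightarrow> ('n, 'a) P \<Rightarrow> nat \<Rightarrow> ('n, 'a) P \<times> nat" where
  "extz 0 E r m = (0, 0)"
| "extz (Suc n) E r 0 = (E r, 0)"
| "extz (Suc n) E r (Suc m) = fdivz (fsub (extz (Suc n) E r m) (extz n (commz E) r (Suc m)))"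

definition dact :: "(('n::finite, 'a::comm_ring_1) S \<Rightarrow> ('n, 'a) S) \<Rightarrow> ('n, 'a) P \<times> nat \<Rightarrow> ('n, 'a) P \<times> nat" where
  "dact f u = extz (Suc (dord f)) (liftop f) (fst u) (snd u)"

(* r/z^k represents 0 in the top Cech cohomology H^{d+1}: it lies in the sum of the images
   of the localizations P_{z/z_i}, i.e. equals (\<Sum>_i s_i z_i^N)/z^N in P_z *)
definition cech_zero :: "('n::finite, 'a::comm_ring_1) P \<times> nat \<Rightarrow> bool" where
  "cech_zero u \<longleftrightarrow> (\<exists>j N s. zprod ^ j * (fst u * zprod ^ N - (\<Sum>i\<in>UNIV. s i * zv i ^ N) * zprod ^ snd u) = 0)"

definition Heq :: "('n::finite, 'a::comm_ring_1) P \<times> nat \<Rightarrow> ('n, 'a) P \<times> nat \<Rightarrow> bool" where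
  "Heq u v \<longleftrightarrow> cech_zero (fsub u v)"

(* \<Theta>: the P-linear map with \<Theta>[1/\<Prod>(y_i-x_i)^(a_i+1)] = \<partial>_a; by P-linearity
   \<Theta>[r/z^m] = r \<cdot> \<partial>_{(m-1,...,m-1)} for m \<ge> 1, and [r/z^0] = 0 *)
definition Theta :: "('n::finite, 'a::comm_ring_1) P \<times> nat \<Rightarrow> (('n, 'a) S \<Rightarrow> ('n, 'a) S)" where
  "Theta u = (if snd u = 0 then (\<lambda>_. 0)
              else pact (fst u) (dpart (\<Sum>i\<in>UNIV. Poly_Mapping.single i (snd u - 1))))"

end

theory Submission
  imports Defs
begin

text \<open>\<open>\<Theta>\<close> of a fraction \<open>w\<close>, applied to a polynomial \<open>s\<close>, is the residue of \<open>w s(y) dy\<close> along the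
  diagonal. All poles in \<open>y\<close> lie on the diagonal, so this residue can be read off as the coefficient of
  \<open>1 / y\<close> in the expansion of \<open>w\<close> at \<open>y = \<infinity>\<close>. There \<open>y\<close> is independent of \<open>x\<close>, so an operator \<open>\<delta>\<close> in
  the \<open>x\<close> variables acts coefficientwise and commutes with taking the residue; since \<open>y - x\<close> is
  injective on series bounded in \<open>y\<close>, the recursion defining the action on fractions forces it to
  agree with this coefficientwise action. Bijectivity follows from Taylor expansion in \<open>y - x\<close>: an
  operator \<open>f\<close> is determined by the values \<open>((y - x)\<^sup>a f)(1)\<close>, which vanish once some \<open>a\<^sub>i\<close> exceeds
  the order of \<open>f\<close>.\<close>

section \<open>Sums over the coefficients of a polynomial\<close>

lemma poly_mapping_induct_single [case_names single add]:
  assumes "\<And>a b. Q (Poly_Mapping.single a b)"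
    and "\<And>f g. Q f \<Longrightarrow> Q g \<Longrightarrow> Q (f + g)"
  shows "Q (p :: 'k \<Rightarrow>\<^sub>0 'b::comm_monoid_add)"
proof (induction p rule: Poly_Mapping.update_induct)
  case const
  show ?case using assms(1)[of undefined 0] by simp
next
  case (update f a b)
  have "Poly_Mapping.update a b f = Poly_Mapping.single a b + f"
    using update(1)
    by (intro poly_mapping_eqI)
      (auto simp: lookup_update lookup_add lookup_single when_def in_keys_iff)
  then show ?case using assms update(3) by metis
qed

text \<open>For fixed \<open>\<phi>\<close> this is the linear functional extending
  \<open>\<phi>\<close> from monomials. The actions of \<open>P\<close> on operators and on series
  are both instances, so multiplicativity is proved only once.\<close>

definition coeff_sum :: "('k \<Rightarrow>\<^sub>0 'r::comm_ring_1) \<Rightarrow> ('k \<Rightarrow> 'r) \<Rightarrow> 'r" where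
  "coeff_sum p \<phi> = (\<Sum>b\<in>Poly_Mapping.keys p. Poly_Mapping.lookup p b * \<phi> b)"

lemma coeff_sum_0 [simp]: "coeff_sum 0 \<phi> = 0"
  by (simp add: coeff_sum_def)

lemma coeff_sum_single [simp]: "coeff_sum (Poly_Mapping.single b c) \<phi> = c * \<phi> b"
  by (simp add: coeff_sum_def)

lemma coeff_sum_add: "coeff_sum (p + q) \<phi> = coeff_sum p \<phi> + coeff_sum q \<phi>"
  unfolding coeff_sum_def
  by (rule setsum_keys_plus_distrib) (auto simp: distrib_right)

lemma coeff_sum_diff: "coeff_sum (p - q) \<phi> = coeff_sum p \<phi> - coeff_sum q \<phi>"
  using coeff_sum_add[of "p - q" q \<phi>] by (simp add: algebra_simps)

lemma coeff_sum_sum: "coeff_sum (\<Sum>i\<in>I. p i) \<phi> = (\<Sum>i\<in>I. coeff_sum (p i) \<phi>)"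
  by (induction I rule: infinite_finite_induct) (auto simp: coeff_sum_add)

lemma coeff_sum_fun_diff:
  "coeff_sum p (\<lambda>b. \<phi> b - \<psi> b) = coeff_sum p \<phi> - coeff_sum p \<psi>"
  by (simp add: coeff_sum_def right_diff_distrib sum_subtractf)

lemma coeff_sum_fun_add:
  "coeff_sum p (\<lambda>b. \<phi> b + \<psi> b) = coeff_sum p \<phi> + coeff_sum p \<psi>"
  by (simp add: coeff_sum_def distrib_left sum.distrib)

lemma coeff_sum_fun_0 [simp]: "coeff_sum p (\<lambda>b. 0) = 0"
  by (simp add: coeff_sum_def)

lemma coeff_sum_mult:
  fixes p q :: "'k::comm_monoid_add \<Rightarrow>\<^sub>0 'r::comm_ring_1"
  shows "coeff_sum (p * q) \<phi> = coeff_sum p (\<lambda>a. coeff_sum q (\<lambda>b. \<phi> (a + b)))"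
proof (induction p rule: poly_mapping_induct_single)
  case (single a c)
  show ?case
  proof (induction q rule: poly_mapping_induct_single)
    case (single b d)
    show ?case by (simp add: mult_single algebra_simps)
  next
    case (add f g)
    then show ?case
      by (simp add: distrib_left coeff_sum_add)
  qed
next
  case (add f g)
  then show ?case by (simp add: distrib_right coeff_sum_add)
qed

section \<open>Linear operators\<close>

lemma AlinI:
  assumes "\<And>s t. f (s + t) = f s + f t" "\<And>c s. f (Sconst c * s) = Sconst c * f s"
  shows "Alin f"
  using assms by (simp add: Alin_def)

lemma Alin_add: "Alin f \<Longrightarrow> f (s + t) = f s + f t"
  by (simp add: Alin_def)

lemma Alin_scale: "Alin f \<Longrightarrow> f (Sconst c * s) = Sconst c * f s"
  by (simp add: Alin_def)

lemma Alin_0: "Alin f \<Longrightarrow> f 0 = 0"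
  using Alin_add[of f 0 0] by simp

lemma Alin_sum: "Alin f \<Longrightarrow> f (\<Sum>i\<in>I. s i) = (\<Sum>i\<in>I. f (s i))"
  by (induction I rule: infinite_finite_induct) (auto simp: Alin_add Alin_0)

lemma single_eq_Sconst_Smonom: "Poly_Mapping.single b c = Sconst c * Smonom b"
  by (simp add: Sconst_def Smonom_def mult_single)

lemma Smonom_mult: "Smonom a * Smonom b = Smonom (a + b)"
  by (simp add: Smonom_def mult_single)

lemma Smonom_0 [simp]: "Smonom 0 = 1"
  by (simp add: Smonom_def)

lemma Alin_eqI:
  assumes "Alin f" "Alin g" "\<And>b. f (Smonom b) = g (Smonom b)"
  shows "f = g"
proof
  fix s
  show "f s = g s"
  proof (induction s rule: poly_mapping_induct_single)
    case (single b c)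
    show ?case
      using assms by (simp add: single_eq_Sconst_Smonom Alin_scale)
  qed (use assms in \<open>simp add: Alin_add\<close>)
qed

lemma Alin_zero: "Alin (\<lambda>s. 0)"
  by (simp add: Alin_def)

lemma Alin_fun_add: "Alin f \<Longrightarrow> Alin g \<Longrightarrow> Alin (\<lambda>s. f s + g s)"
  by (simp add: Alin_def algebra_simps)

lemma Alin_fun_diff: "Alin f \<Longrightarrow> Alin g \<Longrightarrow> Alin (\<lambda>s. f s - g s)"
  by (simp add: Alin_def algebra_simps)

lemma Alin_mult_left: "Alin f \<Longrightarrow> Alin (\<lambda>s. t * f s)"
  by (simp add: Alin_def algebra_simps)

lemma Alin_mult_right: "Alin f \<Longrightarrow> Alin (\<lambda>s. f (t * s))"
  by (intro AlinI) (simp_all only: distrib_left Alin_add mult.left_commute[of t] Alin_scale)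

lemma Alin_fun_sum: "(\<And>i. i \<in> I \<Longrightarrow> Alin (f i)) \<Longrightarrow> Alin (\<lambda>s. \<Sum>i\<in>I. f i s)"
  by (induction I rule: infinite_finite_induct) (auto simp: Alin_zero Alin_fun_add)

lemma Alin_comp: "Alin f \<Longrightarrow> Alin g \<Longrightarrow> Alin (f \<circ> g)"
  by (simp add: Alin_def)

section \<open>The action of \<open>P\<close> on operators and the divided power operators\<close>

lemma pact_eq: "pact p f s = coeff_sum p (\<lambda>b. f (Smonom b * s))"
  by (simp add: pact_def coeff_sum_def)

lemma pact_mult: "pact (p * q) f = pact p (pact q f)"
proof
  fix s :: "('a, 'b) S"
  have "Smonom (a + b) * s = Smonom b * (Smonom a * s)" for a b
    by (simp add: mult.assoc[symmetric] Smonom_mult add.commute)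
  then show "pact (p * q) f s = pact p (pact q f) s"
    by (simp only: pact_eq coeff_sum_mult)
qed

lemma Alin_pact:
  assumes "Alin f"
  shows "Alin (pact p f)"
  unfolding pact_def
  by (intro Alin_fun_sum Alin_mult_left Alin_mult_right assms)

lemma dpart_single:
  "dpart a (Poly_Mapping.single b c) =
    (if \<forall>i. Poly_Mapping.lookup a i \<le> Poly_Mapping.lookup b i
     then Poly_Mapping.single (b - a)
       (of_nat (\<Prod>i\<in>UNIV. Poly_Mapping.lookup b i choose Poly_Mapping.lookup a i) * c) else 0)"
  by (simp add: dpart_def)

lemma dpart_add: "dpart a (s + t) = dpart a s + dpart a t"
  unfolding dpart_def
  by (rule setsum_keys_plus_distrib) (auto simp: distrib_left single_add)

lemma Alin_dpart: "Alin (dpart a)"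
proof (rule AlinI)
  show "dpart a (Sconst c * s) = Sconst c * dpart a s" for c and s :: "('a, 'b) S"
  proof (induction s rule: poly_mapping_induct_single)
    case (single b d)
    show ?case
      by (simp add: Sconst_def mult_single dpart_single mult.left_commute)
  qed (simp add: distrib_left dpart_add)
qed (rule dpart_add)

section \<open>Expansion at infinity\<close>

text \<open>A function \<open>h\<close> on integer exponent vectors stands for the formal series with coefficient
  \<open>h k\<close> at \<open>y\<close> to the power \<open>-1 - k\<close>. All polynomials act on such functions, without any
  condition on supports.\<close>

definition laurent_act ::
  "('n, 'a::comm_ring_1) P \<Rightarrow> (('n \<Rightarrow> int) \<Rightarrow> ('n, 'a) S) \<Rightarrow> ('n \<Rightarrow> int) \<Rightarrow> ('n, 'a) S" where
  "laurent_act p h k = coeff_sum p (\<lambda>b. h (\<lambda>i. k i + int (Poly_Mapping.lookup b i)))"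

lemma laurent_act_mult: "laurent_act (p * q) h = laurent_act p (laurent_act q h)"
  by (rule ext) (simp add: laurent_act_def coeff_sum_mult lookup_add add.assoc)

lemma laurent_act_0 [simp]: "laurent_act 0 h k = 0"
  by (simp add: laurent_act_def)

lemma laurent_act_1 [simp]: "laurent_act 1 h = h"
  by (rule ext) (simp add: laurent_act_def coeff_sum_def)

lemma laurent_act_diff: "laurent_act (p - q) h k = laurent_act p h k - laurent_act q h k"
  by (simp add: laurent_act_def coeff_sum_diff)

lemma laurent_act_add: "laurent_act (p + q) h k = laurent_act p h k + laurent_act q h k"
  by (simp add: laurent_act_def coeff_sum_add)

lemma laurent_act_fun_diff:
  "laurent_act p (\<lambda>k. h k - g k) k = laurent_act p h k - laurent_act p g k"
  by (simp add: laurent_act_def coeff_sum_fun_diff)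

lemma laurent_act_fun_add:
  "laurent_act p (\<lambda>k. h k + g k) k = laurent_act p h k + laurent_act p g k"
  by (simp add: laurent_act_def coeff_sum_fun_add)

abbreviation xvar :: "'n \<Rightarrow> ('n, 'a::comm_ring_1) S" where
  "xvar i \<equiv> Smonom (Poly_Mapping.single i 1)"

lemma laurent_act_zv: "laurent_act (zv i) h k = h (k(i := k i + 1)) - xvar i * h k"
proof -
  have "(\<lambda>j. k j + int (Poly_Mapping.lookup (Poly_Mapping.single i 1) j)) = k(i := k i + 1)"
    by (auto simp: lookup_single when_def)
  then show ?thesis
    by (simp add: zv_def Xv_def Yv_def laurent_act_def coeff_sum_diff)
qed

text \<open>The coefficients of the geometric expansion of \<open>1 / (y\<^sub>i - x\<^sub>i) ^ a\<close> in powers of \<open>1 / y\<^sub>i\<close>.\<close>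

definition inv_power_coeff :: "'n \<Rightarrow> nat \<Rightarrow> int \<Rightarrow> ('n, 'a::comm_ring_1) S" where
  "inv_power_coeff i a k =
    (if a = 0 then (if k = - 1 then 1 else 0)
     else if k < 0 then 0
     else of_nat (nat k choose (a - 1)) * xvar i ^ (nat k - (a - 1)))"

text \<open>The expansion at infinity of the product of the (y_i - x_i)^(- c i). A factor with
  \<open>c i = 0\<close> is the constant 1, which sits at index -1 because index k stands for the
  power -1 - k.\<close>

definition inv_series :: "('n::finite \<Rightarrow> nat) \<Rightarrow> ('n \<Rightarrow> int) \<Rightarrow> ('n, 'a::comm_ring_1) S" where
  "inv_series c k = (\<Prod>i\<in>UNIV. inv_power_coeff i (c i) (k i))"

text \<open>Coefficientwise form of (y - x) (y - x)^(-a-1) = (y - x)^(-a). For nonnegative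
  \<open>k\<close> and positive \<open>a\<close> it is Pascal's rule.\<close>

lemma inv_power_coeff_rec:
  "inv_power_coeff i (Suc a) (k + 1) - xvar i * inv_power_coeff i (Suc a) k =
    (inv_power_coeff i a k :: ('n, 'a::comm_ring_1) S)"
proof -
  consider "k < - 1" | "k = - 1" | n where "k = int n"
    using nonneg_int_cases[of k] by force
  then show ?thesis
  proof cases
    case 3
    have n: "nat (int n + 1) = Suc n" by simp
    show ?thesis
    proof (cases a)
      case 0
      then show ?thesis using 3 by (simp add: inv_power_coeff_def n)
    next
      case (Suc a')
      show ?thesis
      \<comment> \<open>Subtraction is truncated: a factor \<open>xvar i\<close> splits off the
        power only in this range, and otherwise the binomial coefficient in front vanishes.\<close>
      proof (cases "Suc a' \<le> n")
        case True
        then have "(xvar i :: ('n, 'a) S) ^ (n - a') = xvar i * xvar i ^ (n - Suc a')"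
          by (metis Suc_diff_Suc Suc_le_lessD power_Suc)
        then show ?thesis using 3 Suc
          by (simp add: inv_power_coeff_def n) (simp add: algebra_simps)
      next
        case False
        then show ?thesis using 3 Suc by (simp add: inv_power_coeff_def n binomial_eq_0)
      qed
    qed
  qed (auto simp: inv_power_coeff_def binomial_eq_0)
qed

lemma laurent_act_zv_inv_series:
  "laurent_act (zv i) (inv_series (c(i := Suc (c i)))) =
    (inv_series c :: _ \<Rightarrow> ('n::finite, 'a::comm_ring_1) S)"
proof
  fix k
  have split: "(\<Prod>j\<in>UNIV. F j) = F i * (\<Prod>j\<in>UNIV - {i}. F j)" for F :: "'n \<Rightarrow> ('n, 'a) S"
    by (rule prod.remove) auto
  define R where "R = (\<Prod>j\<in>UNIV - {i}. inv_power_coeff j (c j) (k j) :: ('n, 'a) S)"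
  have R': "(\<Prod>j\<in>UNIV - {i}. inv_power_coeff j ((c(i := Suc (c i))) j) ((k(i := m)) j)) = R" for m
    unfolding R_def by (rule prod.cong) auto
  have "inv_series (c(i := Suc (c i))) (k(i := m)) = inv_power_coeff i (Suc (c i)) m * R" for m
    unfolding inv_series_def split R' by simp
  note A = this[of "k i + 1"] this[of "k i", unfolded fun_upd_triv]
  have "inv_series c k = inv_power_coeff i (c i) (k i) * R"
    unfolding inv_series_def split R_def by simp
  also have "\<dots> = inv_power_coeff i (Suc (c i)) (k i + 1) * R
      - xvar i * (inv_power_coeff i (Suc (c i)) (k i) * R)"
    unfolding inv_power_coeff_rec[of i "c i" "k i", symmetric]
    by (simp only: left_diff_distrib mult.assoc)
  also have "\<dots> = laurent_act (zv i) (inv_series (c(i := Suc (c i)))) k"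
    unfolding laurent_act_zv A ..
  finally show "laurent_act (zv i) (inv_series (c(i := Suc (c i)))) k = (inv_series c k :: ('n, 'a) S)"
    by (rule sym)
qed

lemma laurent_act_zv_power_inv_series:
  "laurent_act (zv i ^ n) (inv_series (c(i := c i + n))) =
    (inv_series c :: _ \<Rightarrow> ('n::finite, 'a::comm_ring_1) S)"
proof (induction n arbitrary: c)
  case (Suc n)
  have "laurent_act (zv i ^ Suc n) (inv_series (c(i := c i + Suc n)))
      = laurent_act (zv i ^ n) (laurent_act (zv i) (inv_series (c(i := c i + Suc n)) :: _ \<Rightarrow> ('n, 'a) S))"
    by (simp only: power_Suc2 laurent_act_mult)
  also have "laurent_act (zv i) (inv_series (c(i := c i + Suc n))) = inv_series (c(i := c i + n))"
    using laurent_act_zv_inv_series[of i "c(i := c i + n)"] by simp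
  finally show ?case by (simp only: Suc.IH)
qed simp

lemma laurent_act_prod_zv_inv_series:
  assumes "finite I"
  shows "laurent_act (\<Prod>i\<in>I. zv i ^ g i) (inv_series (\<lambda>i. if i \<in> I then c i + g i else c i)) =
    (inv_series c :: _ \<Rightarrow> ('n::finite, 'a::comm_ring_1) S)"
  using assms
proof (induction I arbitrary: c)
  case (insert j I)
  let ?d = "\<lambda>i. if i \<in> I then c i + g i else c i"
  have "(\<lambda>i. if i \<in> insert j I then c i + g i else c i) = ?d(j := ?d j + g j)"
    using insert(2) by auto
  then have "laurent_act (zv j ^ g j) (inv_series (\<lambda>i. if i \<in> insert j I then c i + g i else c i))
      = (inv_series ?d :: _ \<Rightarrow> ('n, 'a) S)"
    using laurent_act_zv_power_inv_series[of j "g j" ?d] by simp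
  moreover have "(\<Prod>i\<in>insert j I. zv i ^ g i) = (\<Prod>i\<in>I. zv i ^ g i) * (zv j ^ g j :: ('n, 'a) P)"
    using insert by (simp add: mult.commute)
  ultimately show ?case by (simp only: laurent_act_mult insert.IH)
qed simp

lemma inv_series_eq_0: "c i = 0 \<Longrightarrow> 0 \<le> k i \<Longrightarrow> inv_series c k = 0"
  unfolding inv_series_def
  by (rule prod_zero, simp, rule bexI[of _ i]) (auto simp: inv_power_coeff_def)

text \<open>\<open>c i = 0\<close> means that there is no pole along y_i = x_i. After multiplication
  by a polynomial only nonnegative powers of y_i occur, and these have negative index.\<close>

lemma laurent_act_inv_series_eq_0:
  fixes p :: "('n::finite, 'a::comm_ring_1) P"
  assumes "c i = 0" "0 \<le> k i"
  shows "laurent_act p (inv_series c) k = 0"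
proof -
  have "inv_series c (\<lambda>j. k j + int (Poly_Mapping.lookup b j)) = (0 :: ('n, 'a) S)"
    for b :: "'n \<Rightarrow>\<^sub>0 nat"
    using assms by (intro inv_series_eq_0[of _ i]) auto
  then show ?thesis by (simp add: laurent_act_def)
qed

section \<open>Monomials in y - x and their residues\<close>

definition zmonom :: "('n::finite \<Rightarrow>\<^sub>0 nat) \<Rightarrow> ('n, 'a::comm_ring_1) P" where
  "zmonom g = (\<Prod>i\<in>UNIV. zv i ^ Poly_Mapping.lookup g i)"

lemma zv_power_dvd_zmonom: "m \<le> Poly_Mapping.lookup g i \<Longrightarrow> zv i ^ m dvd zmonom g"
  unfolding zmonom_def by (meson dvd_trans le_imp_power_dvd dvd_prodI finite UNIV_I)

text \<open>Index 0 reads off the residue of (y - x)^(g - a - 1). If an entry of \<open>g\<close>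
  exceeds that of \<open>a\<close>, the pole in that variable cancels. Otherwise the expansion in
  descending powers starts at y^(g - a - 1), which reaches 1/y only for
  \<open>g = a\<close>.\<close>

lemma laurent_act_zmonom_at_0:
  fixes a g :: "'n::finite \<Rightarrow>\<^sub>0 nat"
  shows "laurent_act (zmonom g) (inv_series (\<lambda>i. Suc (Poly_Mapping.lookup a i))) (\<lambda>_. 0) =
    (if g = a then 1 else (0 :: ('n, 'a::comm_ring_1) S))"
proof (cases "\<exists>i. Poly_Mapping.lookup a i < Poly_Mapping.lookup g i")
  case True
  then obtain i where i: "Poly_Mapping.lookup a i < Poly_Mapping.lookup g i" by blast
  let ?c = "\<lambda>i. Suc (Poly_Mapping.lookup a i)"
  have "zv i ^ Suc (Poly_Mapping.lookup a i) dvd (zmonom g :: ('n, 'a) P)"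
    using i by (intro zv_power_dvd_zmonom) simp
  then obtain q where q: "(zmonom g :: ('n, 'a) P) = q * zv i ^ Suc (Poly_Mapping.lookup a i)"
    by (metis dvd_def mult.commute)
  have "laurent_act (zv i ^ Suc (Poly_Mapping.lookup a i)) (inv_series ?c) =
      (inv_series (?c(i := 0)) :: _ \<Rightarrow> ('n, 'a) S)"
    using laurent_act_zv_power_inv_series[of i "Suc (Poly_Mapping.lookup a i)" "?c(i := 0)"]
    by (simp add: fun_upd_idem)
  then show ?thesis
    using i unfolding q laurent_act_mult by (auto intro: laurent_act_inv_series_eq_0[of _ i])
next
  case False
  then have le: "Poly_Mapping.lookup g i \<le> Poly_Mapping.lookup a i" for i
    by (meson not_less)
  let ?c = "\<lambda>i. Suc (Poly_Mapping.lookup a i - Poly_Mapping.lookup g i)"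
  have "laurent_act (zmonom g) (inv_series (\<lambda>i. Suc (Poly_Mapping.lookup a i)))
      = (inv_series ?c :: _ \<Rightarrow> ('n, 'a) S)"
    using laurent_act_prod_zv_inv_series[of UNIV "Poly_Mapping.lookup g" ?c] le
    by (simp add: zmonom_def)
  moreover have "inv_series ?c (\<lambda>_. 0) = (if g = a then 1 else (0 :: ('n, 'a) S))"
  proof (cases "g = a")
    case True
    then show ?thesis by (simp add: inv_series_def inv_power_coeff_def)
  next
    case False
    then obtain i where "Poly_Mapping.lookup g i \<noteq> Poly_Mapping.lookup a i"
      by (meson poly_mapping_eqI)
    with le[of i] have "0 < Poly_Mapping.lookup a i - Poly_Mapping.lookup g i" by simp
    then have "inv_power_coeff i (?c i) 0 = (0 :: ('n, 'a) S)"
      by (simp add: inv_power_coeff_def binomial_eq_0)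
    then have "inv_series ?c (\<lambda>_. 0) = (0 :: ('n, 'a) S)"
      unfolding inv_series_def by (intro prod_zero) auto
    with False show ?thesis by simp
  qed
  ultimately show ?thesis by simp
qed

lemma laurent_act_zprod_power_inv_series:
  "laurent_act (zprod ^ n) (inv_series (\<lambda>_. m + n)) = inv_series (\<lambda>_. m)"
  using laurent_act_prod_zv_inv_series[of UNIV "\<lambda>_. n" "\<lambda>_. m"]
  by (simp add: zprod_def prod_power_distrib)

lemma Smonom_eq_prod:
  "(Smonom b :: ('n::finite, 'a::comm_ring_1) S) = (\<Prod>i\<in>UNIV. xvar i ^ Poly_Mapping.lookup b i)"
proof -
  have pw: "(xvar i :: ('n, 'a) S) ^ n = Smonom (Poly_Mapping.single i n)" for i n
    by (induction n) (auto simp: Smonom_mult single_add[symmetric])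
  have "(\<Prod>i\<in>I. Smonom (f i)) = (Smonom (\<Sum>i\<in>I. f i) :: ('n, 'a) S)" for I :: "'n set" and f
    by (induction I rule: infinite_finite_induct) (auto simp: Smonom_mult)
  moreover have "(\<Sum>i\<in>UNIV. Poly_Mapping.single i (Poly_Mapping.lookup b i)) = b"
    by (rule poly_mapping_eqI) (simp add: lookup_sum lookup_single when_def)
  ultimately show ?thesis by (simp only: pw)
qed

text \<open>The binomials and powers in \<open>dpart\<close> are the coefficients of 1 / (y - x)^(a
  + 1), and index \<open>b\<close> selects the residue after multiplication by y^b.\<close>

lemma dpart_Smonom:
  "dpart a (Smonom b) = inv_series (\<lambda>i. Suc (Poly_Mapping.lookup a i)) (\<lambda>i. int (Poly_Mapping.lookup b i))"
proof (cases "\<forall>i. Poly_Mapping.lookup a i \<le> Poly_Mapping.lookup b i")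
  case True
  let ?N = "\<Prod>i\<in>UNIV. Poly_Mapping.lookup b i choose Poly_Mapping.lookup a i"
  have "dpart a (Smonom b) = Poly_Mapping.single 0 (of_nat ?N) * Smonom (b - a)"
    using True by (simp add: Smonom_def dpart_single mult_single)
  also have "Poly_Mapping.single 0 (of_nat ?N) = of_nat ?N"
    by (rule single_of_nat)
  finally show ?thesis
    by (simp add: Smonom_eq_prod[of "b - a"] inv_series_def inv_power_coeff_def prod.distrib
        lookup_minus)
next
  case False
  then obtain i where i: "Poly_Mapping.lookup b i < Poly_Mapping.lookup a i"
    by (meson not_less)
  then have "inv_power_coeff i (Suc (Poly_Mapping.lookup a i)) (int (Poly_Mapping.lookup b i)) = (0 :: ('a, 'b) S)"
    by (simp add: inv_power_coeff_def binomial_eq_0)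
  then have "inv_series (\<lambda>i. Suc (Poly_Mapping.lookup a i)) (\<lambda>i. int (Poly_Mapping.lookup b i)) = (0 :: ('a, 'b) S)"
    unfolding inv_series_def by (intro prod_zero) auto
  with False show ?thesis by (simp only: Smonom_def dpart_single if_False)
qed

lemma pact_dpart_Smonom:
  "pact p (dpart a) (Smonom b) =
    laurent_act p (inv_series (\<lambda>i. Suc (Poly_Mapping.lookup a i))) (\<lambda>i. int (Poly_Mapping.lookup b i))"
  by (simp add: pact_eq laurent_act_def Smonom_mult dpart_Smonom lookup_add add.commute)

section \<open>\<open>\<Theta>\<close> as a residue\<close>

lemma Alin_Theta: "Alin (Theta u)"
  by (simp add: Theta_def Alin_zero Alin_pact Alin_dpart)

text \<open>The residue along the diagonal is the coefficient of \<open>1 / y\<close> in the expansion at infinity.\<close>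

lemma Theta_Smonom:
  "Theta u (Smonom b) =
    laurent_act (fst u) (inv_series (\<lambda>_. snd u)) (\<lambda>i. int (Poly_Mapping.lookup b i))"
proof (cases "snd u")
  case 0
  then show ?thesis by (simp add: Theta_def laurent_act_inv_series_eq_0)
next
  case (Suc m)
  then show ?thesis
    by (simp add: Theta_def pact_dpart_Smonom lookup_sum lookup_single when_def)
qed


lemma Theta_fsub: "Theta (fsub u v) = (\<lambda>s. Theta u s - Theta v s)"
proof (rule Alin_eqI)
  fix b
  have "laurent_act (zprod ^ snd v) (inv_series (\<lambda>_. snd u + snd v)) = (inv_series (\<lambda>_. snd u) :: _ \<Rightarrow> ('a, 'b) S)"
    by (rule laurent_act_zprod_power_inv_series)
  moreover have "laurent_act (zprod ^ snd u) (inv_series (\<lambda>_. snd u + snd v)) = (inv_series (\<lambda>_. snd v) :: _ \<Rightarrow> ('a, 'b) S)"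
    using laurent_act_zprod_power_inv_series[of "snd u" "snd v"] by (simp add: add.commute)
  ultimately show "Theta (fsub u v) (Smonom b) = Theta u (Smonom b) - Theta v (Smonom b)"
    by (simp add: Theta_Smonom fsub_def laurent_act_diff laurent_act_mult)
qed (simp_all add: Alin_Theta Alin_fun_diff)

text \<open>A summand s_i z_i^N / z^N has no pole along y_i = x_i, hence no residue.\<close>

lemma Theta_eq_0_if_cech_zero:
  fixes u :: "('n::finite, 'a::comm_ring_1) P \<times> nat"
  assumes "cech_zero u"
  shows "Theta u = (\<lambda>_. 0)"
proof (rule Alin_eqI)
  fix b :: "'n \<Rightarrow>\<^sub>0 nat"
  define k where "k = (\<lambda>i. int (Poly_Mapping.lookup b i))"
  obtain j N s where z:
    "zprod ^ j * (fst u * zprod ^ N - (\<Sum>i\<in>UNIV. s i * zv i ^ N) * zprod ^ snd u) = 0"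
    using assms unfolding cech_zero_def by blast
  let ?inv = "\<lambda>m. inv_series (\<lambda>_::'n. m) :: _ \<Rightarrow> ('n, 'a) S"
  define T where "T = (\<Sum>i\<in>UNIV. s i * zv i ^ N)"
  have eq: "fst u * (zprod ^ N * zprod ^ j) - T * (zprod ^ snd u * zprod ^ j) = 0"
    using z unfolding T_def by (simp add: algebra_simps)
  \<comment> \<open>Testing the relation against the expansion of z^-(snd u + N + j) absorbs z^j and
    leaves each numerator over its own denominator.\<close>
  have 1: "laurent_act (zprod ^ N * zprod ^ j) (?inv (snd u + N + j)) = ?inv (snd u)"
    using laurent_act_zprod_power_inv_series[of "N + j" "snd u"]
    by (simp add: power_add add.assoc)
  have 2: "laurent_act (zprod ^ snd u * zprod ^ j) (?inv (snd u + N + j)) = ?inv N"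
    using laurent_act_zprod_power_inv_series[of "snd u + j" N]
    by (simp add: power_add ac_simps)
  have T: "laurent_act T (?inv N) k = 0"
  proof -
    have "laurent_act (s i * zv i ^ N) (?inv N) k = 0" for i
    proof -
      have "laurent_act (zv i ^ N) (?inv N) = inv_series ((\<lambda>_. N)(i := 0))"
        using laurent_act_zv_power_inv_series[of i N "(\<lambda>_. N)(i := 0)"] by (simp add: fun_upd_idem)
      then show ?thesis
        by (simp add: laurent_act_mult laurent_act_inv_series_eq_0[of _ i] k_def)
    qed
    then show ?thesis by (simp add: T_def laurent_act_def coeff_sum_sum)
  qed
  have "0 = laurent_act (fst u * (zprod ^ N * zprod ^ j) - T * (zprod ^ snd u * zprod ^ j))
      (?inv (snd u + N + j)) k"
    unfolding eq by simp
  also have "\<dots> = laurent_act (fst u) (?inv (snd u)) k - laurent_act T (?inv N) k"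
    unfolding laurent_act_diff laurent_act_mult[of "fst u"] laurent_act_mult[of T] 1 2 ..
  finally show "Theta u (Smonom b) = 0"
    using T by (simp add: Theta_Smonom k_def)
qed (simp_all add: Alin_Theta Alin_zero)

section \<open>Differential operators\<close>

lemma Alin_if_diffop: "diffop n f \<Longrightarrow> Alin f"
  by (cases n) auto

lemma diffop_zero: "diffop n (\<lambda>_. 0)"
  by (induction n) (auto simp: Alin_zero)

lemma diffop_add:
  "diffop n f \<Longrightarrow> diffop n g \<Longrightarrow> diffop n (\<lambda>t. f t + g t)"
proof (induction n arbitrary: f g)
  case 0
  then show ?case by (auto simp: Alin_fun_add distrib_left)
next
  case (Suc n)
  have "(\<lambda>t. (f (s * t) + g (s * t)) - s * (f t + g t)) =
      (\<lambda>t. (f (s * t) - s * f t) + (g (s * t) - s * g t))" for s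
    by (simp add: algebra_simps)
  with Suc show ?case by (auto simp: Alin_fun_add)
qed

lemma diffop_mult_left: "diffop n f \<Longrightarrow> diffop n (\<lambda>t. r * f t)"
proof (induction n arbitrary: f)
  case 0
  then have "r * f (s * t) = s * (r * f t)" for s t
    by (metis diffop.simps(1) mult.left_commute)
  with Alin_mult_left[OF Alin_if_diffop[OF 0], of r] show ?case by simp
next
  case (Suc n)
  have "(\<lambda>t. r * f (s * t) - s * (r * f t)) = (\<lambda>t. r * (f (s * t) - s * f t))" for s
    by (simp add: right_diff_distrib mult.left_commute[of r])
  with Suc show ?case by (auto simp: Alin_mult_left)
qed

lemma diffop_mult_right: "diffop n f \<Longrightarrow> diffop n (\<lambda>t. f (r * t))"
proof (induction n arbitrary: f)
  case 0
  then have "f (r * (s * t)) = s * f (r * t)" for s t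
    by (metis diffop.simps(1) mult.left_commute)
  with Alin_mult_right[OF Alin_if_diffop[OF 0], of r] show ?case by simp
next
  case (Suc n)
  have "(\<lambda>t. f (r * (s * t)) - s * f (r * t)) = (\<lambda>t. (\<lambda>t. f (s * t) - s * f t) (r * t))" for s
    by (simp add: mult.left_commute[of r])
  with Suc show ?case by (auto simp: Alin_mult_right)
qed

lemma diffop_sum: "(\<And>i. i \<in> I \<Longrightarrow> diffop n (f i)) \<Longrightarrow> diffop n (\<lambda>t. \<Sum>i\<in>I. f i t)"
  by (induction I rule: infinite_finite_induct) (auto simp: diffop_zero diffop_add)

lemma diffop_pact: "diffop n f \<Longrightarrow> diffop n (pact p f)"
  unfolding pact_def by (intro diffop_sum diffop_mult_left diffop_mult_right)

text \<open>Since \<open>[f, s t] = [f, s] t + s [f, t]\<close>, it suffices to control commutators with variables.\<close>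

lemma commutator_closure:
  fixes f :: "('n::finite, 'a::comm_ring_1) S \<Rightarrow> ('n, 'a) S"
  assumes f: "Alin f" and zero: "Q (\<lambda>_. 0)"
    and add: "\<And>g h. Q g \<Longrightarrow> Q h \<Longrightarrow> Q (\<lambda>t. g t + h t)"
    and left: "\<And>g s. Q g \<Longrightarrow> Q (\<lambda>t. s * g t)"
    and right: "\<And>g s. Q g \<Longrightarrow> Q (\<lambda>t. g (s * t))"
    and var: "\<And>i. Q (\<lambda>t. f (xvar i * t) - xvar i * f t)"
  shows "Q (\<lambda>t. f (s * t) - s * f t)"
proof -
  define M where "M = {s. Q (\<lambda>t. f (s * t) - s * f t)}"
  have const: "Sconst c \<in> M" for c
    using zero by (simp add: M_def Alin_scale[OF f])
  have "1 \<in> M" using const[of 1] by (simp add: Sconst_def)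
  have mult: "s * r \<in> M" if "s \<in> M" "r \<in> M" for s r
  proof -
    have "(\<lambda>t. f (s * r * t) - s * r * f t) =
        (\<lambda>t. (\<lambda>t. f (s * t) - s * f t) (r * t) + s * (f (r * t) - r * f t))"
      by (simp add: right_diff_distrib mult.assoc)
    then show ?thesis
      using that add[OF right[of "\<lambda>t. f (s * t) - s * f t" r] left[of "\<lambda>t. f (r * t) - r * f t" s]]
      by (simp add: M_def)
  qed
  have plus: "s + r \<in> M" if "s \<in> M" "r \<in> M" for s r
  proof -
    have "(\<lambda>t. f ((s + r) * t) - (s + r) * f t) =
        (\<lambda>t. (f (s * t) - s * f t) + (f (r * t) - r * f t))"
      by (simp add: distrib_right Alin_add[OF f] algebra_simps)
    then show ?thesis using that add by (simp add: M_def)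
  qed
  have "xvar i \<in> M" for i
    using var by (simp add: M_def)
  then have pow: "xvar i ^ n \<in> M" for i n
    using \<open>1 \<in> M\<close> by (induction n) (auto intro!: mult)
  have "(\<Prod>i\<in>I. xvar i ^ g i) \<in> M" for I g
    by (induction I rule: infinite_finite_induct) (auto intro!: mult \<open>1 \<in> M\<close> pow simp del: One_nat_def)
  then have mon: "Smonom b \<in> M" for b
    by (subst Smonom_eq_prod)
  have "s \<in> M"
    by (induction s rule: poly_mapping_induct_single)
      (auto simp: single_eq_Sconst_Smonom intro: mult plus const mon)
  then show ?thesis by (simp add: M_def)
qed

text \<open>This ties the order of an operator to powers of \<open>zv i\<close>: the action of
  \<open>zv i\<close> is the commutator with x_i.\<close>

lemma pact_zv: "pact (zv i) f = (\<lambda>s. f (xvar i * s) - xvar i * f s)"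
  by (rule ext) (simp add: pact_eq zv_def Xv_def Yv_def coeff_sum_diff)

text \<open>Multiplication by y_i - x_i lowers the pole order in the i-th variable by one. A simple
  pole disappears, which leaves the zero operator.\<close>

lemma pact_zv_dpart:
  fixes a :: "'n::finite \<Rightarrow>\<^sub>0 nat"
  shows "pact (zv i) (dpart a) =
    (if Poly_Mapping.lookup a i = 0 then (\<lambda>_. 0)
     else dpart (a - Poly_Mapping.single i 1) :: ('n, 'a::comm_ring_1) S \<Rightarrow> ('n, 'a) S)"
proof (rule Alin_eqI)
  fix b :: "'n \<Rightarrow>\<^sub>0 nat"
  let ?c = "\<lambda>i. Suc (Poly_Mapping.lookup a i)"
  let ?k = "\<lambda>i. int (Poly_Mapping.lookup b i)"
  let ?d = "?c(i := Poly_Mapping.lookup a i)"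
  have "?d(i := Suc (?d i)) = ?c" by auto
  then have eq: "pact (zv i) (dpart a) (Smonom b) = (inv_series ?d ?k :: ('n, 'a) S)"
    unfolding pact_dpart_Smonom
    using laurent_act_zv_inv_series[of i ?d, where ?'a = 'a] by simp
  show "pact (zv i) (dpart a) (Smonom b) = (if Poly_Mapping.lookup a i = 0 then (\<lambda>_. 0)
     else dpart (a - Poly_Mapping.single i 1) :: ('n, 'a) S \<Rightarrow> ('n, 'a) S) (Smonom b)"
  proof (cases "Poly_Mapping.lookup a i = 0")
    case True
    then show ?thesis using eq inv_series_eq_0[of ?d i ?k] by simp
  next
    case False
    then have "?d = (\<lambda>j. Suc (Poly_Mapping.lookup (a - Poly_Mapping.single i 1) j))"
      by (auto simp: lookup_minus lookup_single when_def)
    then show ?thesis using eq False by (simp add: dpart_Smonom)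
  qed
qed (auto simp: Alin_pact Alin_dpart Alin_zero)

text \<open>Induction on the total degree of \<open>a\<close>: nonzero commutators with variables
  have degree one less, and \<open>commutator_closure\<close> passes from variables to all of
  \<open>S\<close>.\<close>

lemma diffop_dpart: "diffop (\<Sum>i\<in>UNIV. Poly_Mapping.lookup a i) (dpart a)"
proof (induction "\<Sum>i\<in>UNIV. Poly_Mapping.lookup a i" arbitrary: a)
  case 0
  then have var: "pact (zv i) (dpart a) = (\<lambda>_. 0 :: ('a, 'b) S)" for i
    by (simp add: pact_zv_dpart)
  have "(\<lambda>t. dpart a (s * t) - s * dpart a t) = (\<lambda>_. 0 :: ('a, 'b) S)" for s
    by (rule commutator_closure[where Q = "\<lambda>g. g = (\<lambda>_. 0)"], rule Alin_dpart)
      (simp_all add: var[unfolded pact_zv] del: One_nat_def)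
  then show ?case
    unfolding 0[symmetric] by (simp add: Alin_dpart fun_eq_iff)
next
  case (Suc n)
  have var: "diffop n (pact (zv i) (dpart a :: ('a, 'b) S \<Rightarrow> _))" for i
  proof (cases "Poly_Mapping.lookup a i = 0")
    case True
    then show ?thesis by (simp add: pact_zv_dpart diffop_zero)
  next
    case False
    have split: "(\<Sum>j\<in>UNIV. F j) = F i + (\<Sum>j\<in>UNIV - {i}. F j)" for F :: "'a \<Rightarrow> nat"
      by (rule sum.remove) auto
    have "(\<Sum>j\<in>UNIV - {i}. Poly_Mapping.lookup (a - Poly_Mapping.single i 1) j) =
        (\<Sum>j\<in>UNIV - {i}. Poly_Mapping.lookup a j)"
      by (rule sum.cong) (auto simp: lookup_minus lookup_single when_def)
    then have "(\<Sum>j\<in>UNIV. Poly_Mapping.lookup (a - Poly_Mapping.single i 1) j) = n"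
      using Suc(2) False split[of "Poly_Mapping.lookup a"]
        split[of "Poly_Mapping.lookup (a - Poly_Mapping.single i 1)"]
      by (simp add: lookup_minus)
    then have "diffop n (dpart (a - Poly_Mapping.single i 1) :: ('a, 'b) S \<Rightarrow> _)"
      using Suc(1)[of "a - Poly_Mapping.single i 1"] by metis
    then show ?thesis
      unfolding pact_zv_dpart using False by simp
  qed
  have "diffop n (\<lambda>t. dpart a (s * t) - s * dpart a t :: ('a, 'b) S)" for s
    by (rule commutator_closure[where Q = "diffop n"], rule Alin_dpart, rule diffop_zero,
        erule (1) diffop_add, erule diffop_mult_left, erule diffop_mult_right,
        rule var[unfolded pact_zv])
  then show ?case unfolding Suc(2)[symmetric] by (simp add: Alin_dpart)
qed

lemma Theta_in_Dops: "Theta u \<in> Dops"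
  unfolding Dops_def Theta_def
  using diffop_zero diffop_pact[OF diffop_dpart] by auto

section \<open>Taylor expansion around the diagonal\<close>

text \<open>Substitutes y_i - x_i for y_i, so that the coefficients of \<open>Q\<close> become
  Taylor coefficients along the diagonal.\<close>

definition taylor_sum :: "('n::finite, 'a::comm_ring_1) P \<Rightarrow> ('n, 'a) P" where
  "taylor_sum Q = (\<Sum>g\<in>Poly_Mapping.keys Q. Poly_Mapping.single 0 (Poly_Mapping.lookup Q g) * zmonom g)"

lemma taylor_sum_single [simp]: "taylor_sum (Poly_Mapping.single g c) = Poly_Mapping.single 0 c * zmonom g"
  by (simp add: taylor_sum_def)

lemma taylor_sum_add: "taylor_sum (Q + R) = taylor_sum Q + taylor_sum R"
  unfolding taylor_sum_def
  by (rule setsum_keys_plus_distrib) (auto simp: distrib_right single_add)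

lemma zmonom_add: "zmonom (g + h) = zmonom g * zmonom h"
  by (simp add: zmonom_def lookup_add power_add prod.distrib)

lemma zmonom_single: "zmonom (Poly_Mapping.single i 1) = zv i"
proof -
  have "zmonom (Poly_Mapping.single i 1) = (\<Prod>j\<in>UNIV. if j = i then zv j else 1)"
    unfolding zmonom_def by (rule prod.cong) (auto simp: lookup_single when_def)
  then show ?thesis by simp
qed

lemma taylor_sum_scale: "Poly_Mapping.single 0 c * taylor_sum Q = taylor_sum (Poly_Mapping.single 0 c * Q)"
proof (induction Q rule: poly_mapping_induct_single)
  case (single g d)
  then show ?case
    by (simp add: mult_single mult.assoc[symmetric])
qed (simp add: distrib_left taylor_sum_add)

lemma taylor_sum_mult_zv: "zv i * taylor_sum Q = taylor_sum (Yv i * Q)"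
proof (induction Q rule: poly_mapping_induct_single)
  case (single g d)
  then show ?case
    by (simp only: Yv_def mult_single taylor_sum_single zmonom_add zmonom_single mult_1 mult.left_commute)
qed (simp add: distrib_left taylor_sum_add)

text \<open>The range of \<open>taylor_sum\<close> contains 1 and is closed under sums, scaling by
  \<open>S\<close> and multiplication by \<open>zv i\<close>, hence under multiplication by y_i =
  z_i + x_i.\<close>

lemma obtain_taylor_sum:
  fixes r :: "('n::finite, 'a::comm_ring_1) P"
  obtains Q where "r = taylor_sum Q"
proof -
  define R where "R = range (taylor_sum :: ('n, 'a) P \<Rightarrow> _)"
  have add: "p + q \<in> R" if "p \<in> R" "q \<in> R" for p q
    using that unfolding R_def by (auto simp: taylor_sum_add[symmetric])
  have scale: "Poly_Mapping.single 0 c * p \<in> R" if "p \<in> R" for p c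
    using that unfolding R_def by (auto simp: taylor_sum_scale)
  have z: "zv i * p \<in> R" if "p \<in> R" for p i
    using that unfolding R_def by (auto simp: taylor_sum_mult_zv)
  have "taylor_sum 1 = (1 :: ('n, 'a) P)"
    by (simp add: taylor_sum_def zmonom_def)
  then have one: "1 \<in> R"
    unfolding R_def by (metis rangeI)
  have y: "Yv i * p \<in> R" if "p \<in> R" for p i
  proof -
    have "Yv i * p = zv i * p + Poly_Mapping.single 0 (xvar i) * p"
      by (simp add: zv_def Xv_def algebra_simps)
    then show ?thesis using add z scale that by simp
  qed
  have ypow: "Yv i ^ n * p \<in> R" if "p \<in> R" for p i n
    using that by (induction n) (auto simp: mult.assoc intro: y)
  have "(\<Prod>i\<in>I. Yv i ^ g i) \<in> R" for I g
    by (induction I rule: infinite_finite_induct) (auto intro: one ypow)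
  \<comment> \<open>\<open>Smonom_eq_prod\<close> is taken over the coefficient ring
    \<open>S\<close>, where its variables are the y_i.\<close>
  then have mon: "Poly_Mapping.single b 1 \<in> R" for b
    using Smonom_eq_prod[of b, where ?'a = "('n, 'a) S"]
    by (simp add: Smonom_def Yv_def)
  have "r \<in> R"
  proof (induction r rule: poly_mapping_induct_single)
    case (single b c)
    show ?case using scale[OF mon[of b], of c] by (simp add: mult_single)
  qed (rule add)
  then show ?thesis using that unfolding R_def by auto
qed

lemma pact_at_1: "pact p f 1 = coeff_sum p (\<lambda>b. f (Smonom b))"
  by (simp add: pact_eq)

lemma pact_taylor_sum_at_1:
  "pact (taylor_sum Q) f 1 =
    (\<Sum>g\<in>Poly_Mapping.keys Q. Poly_Mapping.lookup Q g * pact (zmonom g) f 1)"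
  by (simp add: taylor_sum_def pact_at_1 coeff_sum_sum coeff_sum_mult)

text \<open>f(x^b) = (y^b f)(1), and Taylor expansion writes y^b as an \<open>S\<close>-combination
  of powers of y - x.\<close>

lemma Alin_eqI_zmonom:
  assumes "Alin f" "Alin g" "\<And>a. pact (zmonom a) f 1 = pact (zmonom a) g 1"
  shows "f = g"
proof (rule Alin_eqI)
  fix b
  obtain Q :: "('a, 'b) P" where Q: "Poly_Mapping.single b 1 = taylor_sum Q"
    by (rule obtain_taylor_sum)
  have "pact (Poly_Mapping.single b 1) f 1 = pact (Poly_Mapping.single b 1) g 1"
    unfolding Q pact_taylor_sum_at_1 assms(3) ..
  then show "f (Smonom b) = g (Smonom b)" by (simp add: pact_at_1)
qed (use assms in auto)

lemma pact_zmonom_dpart_at_1: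
  "pact (zmonom g) (dpart a) 1 = (if g = a then 1 else (0 :: ('n::finite, 'a::comm_ring_1) S))"
  using pact_dpart_Smonom[of "zmonom g :: ('n, 'a) P" a 0]
    laurent_act_zmonom_at_0[of g a, where ?'a = 'a] by simp

section \<open>Kernel and image of \<open>Theta\<close> via Taylor coefficients\<close>

abbreviation const_exp :: "nat \<Rightarrow> 'n::finite \<Rightarrow>\<^sub>0 nat" where
  "const_exp n \<equiv> \<Sum>i\<in>UNIV. Poly_Mapping.single i n"

lemma lookup_const_exp [simp]: "Poly_Mapping.lookup (const_exp n) i = n"
  by (simp add: lookup_sum lookup_single when_def)

text \<open>Within the bound the truncated subtraction is a true complement. Multiplying by
  \<open>zmonom (const_exp n - a)\<close> and pairing with \<open>dpart (const_exp n)\<close>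
  therefore isolates the Taylor coefficient at \<open>a\<close>.\<close>

lemma add_const_exp_diff_eq_iff:
  assumes "\<And>i. Poly_Mapping.lookup a i \<le> n"
  shows "g + (const_exp n - a) = const_exp n \<longleftrightarrow> g = a"
proof -
  have "x + (n - Poly_Mapping.lookup a i) = n \<longleftrightarrow> x = Poly_Mapping.lookup a i" for x i
    using assms[of i] by auto
  then show ?thesis
    by (simp add: poly_mapping_eq_iff fun_eq_iff lookup_add lookup_minus)
qed

lemma sum_dvd_zv_powers:
  fixes p :: "'k \<Rightarrow> ('n::finite, 'a::comm_ring_1) P"
  assumes "\<And>g. g \<in> G \<Longrightarrow> \<exists>i. zv i ^ m dvd p g"
  shows "\<exists>s. (\<Sum>g\<in>G. p g) = (\<Sum>i\<in>UNIV. s i * zv i ^ m)"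
  using assms
proof (induction G rule: infinite_finite_induct)
  case (insert x G)
  obtain s where s: "(\<Sum>g\<in>G. p g) = (\<Sum>i\<in>UNIV. s i * zv i ^ m)"
    using insert by auto
  obtain i q where "p x = zv i ^ m * q"
    using insert(4)[of x] by (auto simp: dvd_def)
  then have "p x = (\<Sum>j\<in>UNIV. (if j = i then q else 0) * zv j ^ m)"
    by (simp add: if_distrib[of "\<lambda>q. q * _"] mult.commute[of q] cong: if_cong)
  then have "(\<Sum>g\<in>insert x G. p g) = (\<Sum>j\<in>UNIV. (s j + (if j = i then q else 0)) * zv j ^ m)"
    using insert s by (simp add: distrib_right sum.distrib add.commute)
  then show ?case by (rule exI[of _ "\<lambda>j. s j + (if j = i then q else 0)"])
qed (auto intro: exI[of _ "\<lambda>_. 0"])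

text \<open>Taylor coefficients of the numerator with all exponents at most \<open>n\<close> are
  residues of multiples of \<open>u\<close>, so they vanish. Every remaining term is divisible by
  some \<open>zv i ^ Suc n\<close>.\<close>

lemma cech_zero_if_Theta_eq_0:
  fixes u :: "('n::finite, 'a::comm_ring_1) P \<times> nat"
  assumes "Theta u = (\<lambda>_. 0)"
  shows "cech_zero u"
proof (cases "snd u")
  case 0
  \<comment> \<open>Without a denominator \<open>N = 0\<close> serves as exponent, and the whole
    numerator is placed at one arbitrary index.\<close>
  have "fst u = (\<Sum>i\<in>UNIV. (if i = undefined then fst u else 0) * zv i ^ 0)"
    by simp
  then have "zprod ^ 0 * (fst u * zprod ^ 0
      - (\<Sum>i\<in>UNIV. (if i = undefined then fst u else 0) * zv i ^ 0) * zprod ^ snd u) = 0"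
    using 0 by simp
  then show ?thesis unfolding cech_zero_def by (intro exI)
next
  case (Suc n)
  obtain Q where Q: "fst u = taylor_sum Q" by (rule obtain_taylor_sum)
  have Theta: "Theta u = pact (fst u) (dpart (const_exp n))"
    using Suc by (simp add: Theta_def)
  have "\<exists>i. Suc n \<le> Poly_Mapping.lookup g i" if g: "g \<in> Poly_Mapping.keys Q" for g
  proof (rule ccontr)
    assume "\<not> ?thesis"
    then have le: "Poly_Mapping.lookup g i \<le> n" for i by (simp add: not_less_eq_eq)
    let ?h = "const_exp n - g"
    have "pact (taylor_sum Q * zmonom ?h) (dpart (const_exp n)) 1 = (0 :: ('n, 'a) S)"
      using assms unfolding Theta Q mult.commute[of "taylor_sum Q"] pact_mult
      by (simp add: pact_eq)
    then have "(\<Sum>k\<in>Poly_Mapping.keys Q. Poly_Mapping.lookup Q k *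
        pact (zmonom (k + ?h)) (dpart (const_exp n)) 1) = (0 :: ('n, 'a) S)"
      by (simp add: pact_mult pact_taylor_sum_at_1 zmonom_add)
    then have "Poly_Mapping.lookup Q g = 0"
      using g le
      by (simp add: pact_zmonom_dpart_at_1 add_const_exp_diff_eq_iff if_distrib[of "\<lambda>q. _ * q"] cong: if_cong)
    then show False using g by (simp add: in_keys_iff)
  qed
  then have "\<exists>s. fst u = (\<Sum>i\<in>UNIV. s i * zv i ^ Suc n)"
    unfolding Q taylor_sum_def
    by (intro sum_dvd_zv_powers) (meson dvd_mult zv_power_dvd_zmonom)
  then obtain s where "fst u = (\<Sum>i\<in>UNIV. s i * zv i ^ Suc n)" ..
  then have "zprod ^ 0 * (fst u * zprod ^ Suc n - (\<Sum>i\<in>UNIV. s i * zv i ^ Suc n) * zprod ^ snd u) = 0"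
    using Suc by simp
  then show ?thesis unfolding cech_zero_def by blast
qed

lemma pact_fun_0 [simp]: "pact p (\<lambda>_. 0) = (\<lambda>_. 0)"
  by (rule ext) (simp add: pact_eq)

text \<open>Each commutator with x_i lowers the order by one, and an operator of order 0 commutes
  with x_i.\<close>

lemma pact_zv_power_eq_0: "diffop n f \<Longrightarrow> pact (zv i ^ Suc n) f = (\<lambda>_. 0)"
proof (induction n arbitrary: f)
  case 0
  then show ?case by (simp add: pact_zv)
next
  case (Suc n)
  have "diffop n (pact (zv i) f)"
    using Suc.prems by (simp add: pact_zv)
  then have "pact (zv i ^ Suc n) (pact (zv i) f) = (\<lambda>_. 0)"
    by (rule Suc.IH)
  then show ?case by (simp only: power_Suc2[of _ "Suc n"] pact_mult)
qed

lemma finite_bounded_exponents: "finite {a :: 'n::finite \<Rightarrow>\<^sub>0 nat. \<forall>i. Poly_Mapping.lookup a i \<le> n}"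
proof (rule finite_imageD)
  show "finite (Poly_Mapping.lookup ` {a :: 'n \<Rightarrow>\<^sub>0 nat. \<forall>i. Poly_Mapping.lookup a i \<le> n})"
    by (rule finite_subset[OF _ finite_set_of_finite_funs[of UNIV "{..n}" 0]]) auto
qed (auto simp: inj_on_def)

text \<open>Taylor's formula: \<open>f\<close> is the sum of \<open>c a\<close> times
  \<open>dpart a\<close> over exponents bounded by \<open>n\<close>.\<close>

lemma obtain_Theta_eq:
  fixes f :: "('n::finite, 'a::comm_ring_1) S \<Rightarrow> ('n, 'a) S"
  assumes f: "diffop n f"
  obtains u where "Theta u = f"
proof -
  define B where "B = {a :: 'n \<Rightarrow>\<^sub>0 nat. \<forall>i. Poly_Mapping.lookup a i \<le> n}"
  have B: "finite B" unfolding B_def by (rule finite_bounded_exponents)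
  define c where "c a = pact (zmonom a) f 1" for a
  \<comment> \<open>Over the common denominator z^(n + 1) the term for \<open>a\<close> represents
    \<open>c a\<close> / (y - x)^(a + 1).\<close>
  define r where "r = (\<Sum>a\<in>B. Poly_Mapping.single 0 (c a) * zmonom (const_exp n - a))"
  have "Theta (r, Suc n) = f"
  proof (rule Alin_eqI_zmonom)
    fix g
    have "pact (zmonom g) (Theta (r, Suc n)) 1 = pact (r * zmonom g) (dpart (const_exp n)) 1"
      by (simp add: Theta_def pact_mult[symmetric] mult.commute)
    also have "\<dots> = (\<Sum>a\<in>B. c a * pact (zmonom (g + (const_exp n - a))) (dpart (const_exp n)) 1)"
      by (simp add: r_def sum_distrib_right pact_at_1 coeff_sum_sum mult.assoc coeff_sum_mult[of "Poly_Mapping.single 0 _"]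
          zmonom_add mult.commute[of "zmonom (_ - _)"])
    also have "\<dots> = (\<Sum>a\<in>B. if g = a then c a else 0)"
      by (rule sum.cong) (auto simp: B_def pact_zmonom_dpart_at_1 add_const_exp_diff_eq_iff)
    also have "\<dots> = (if g \<in> B then c g else 0)"
      using B by simp
    also have "\<dots> = pact (zmonom g) f 1"
    proof (cases "g \<in> B")
      \<comment> \<open>Outside \<open>B\<close> some \<open>zv i\<close> occurs to a power above
        \<open>n\<close>, which annihilates \<open>f\<close>.\<close>
      case False
      then obtain i where "Suc n \<le> Poly_Mapping.lookup g i"
        by (auto simp: B_def not_le Suc_le_eq)
      then obtain q where "zmonom g = q * (zv i ^ Suc n :: ('n, 'a) P)"
        by (metis dvd_def mult.commute zv_power_dvd_zmonom)
      then show ?thesis using False f by (simp only: pact_mult pact_zv_power_eq_0 pact_fun_0 if_False)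
    qed (simp add: c_def)
    finally show "pact (zmonom g) (Theta (r, Suc n)) 1 = pact (zmonom g) f 1" .
  qed (use f Alin_Theta Alin_if_diffop in auto)
  then show ?thesis by (rule that)
qed

section \<open>The action of differential operators\<close>

text \<open>An index far below zero means a high power of y_i, so this bounds the powers of y from
  above.\<close>

definition bounded_series :: "(('n \<Rightarrow> int) \<Rightarrow> ('n, 'a::comm_ring_1) S) \<Rightarrow> bool" where
  "bounded_series h \<longleftrightarrow> (\<exists>N. \<forall>k i. k i < N \<longrightarrow> h k = 0)"

lemma bounded_series_inv_series: "bounded_series (inv_series c)"
proof -
  have "inv_series c k = (0 :: ('a, 'b) S)" if "k i < - 1" for k i
    unfolding inv_series_def
    by (rule prod_zero, simp, rule bexI[of _ i]) (use that in \<open>auto simp: inv_power_coeff_def\<close>)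
  then show ?thesis unfolding bounded_series_def by (intro exI allI impI)
qed

lemma bounded_series_add:
  assumes "bounded_series h" "bounded_series g"
  shows "bounded_series (\<lambda>k. h k + g k)"
proof -
  from assms obtain M N where "\<And>k i. k i < M \<Longrightarrow> h k = 0" "\<And>k i. k i < N \<Longrightarrow> g k = 0"
    unfolding bounded_series_def by blast
  then have "h k + g k = 0" if "k i < min M N" for k i
    using that by (metis add.right_neutral min_less_iff_conj)
  then show ?thesis unfolding bounded_series_def by (intro exI allI impI)
qed

lemma bounded_series_map:
  assumes "bounded_series h" "f 0 = 0"
  shows "bounded_series (\<lambda>k. f (h k))"
  using assms unfolding bounded_series_def by metis

lemma bounded_series_diff:
  "bounded_series h \<Longrightarrow> bounded_series g \<Longrightarrow> bounded_series (\<lambda>k. h k - g k)"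
  using bounded_series_add[of h "\<lambda>k. - g k"] bounded_series_map[of g uminus] by simp

lemma bounded_series_laurent_act:
  fixes p :: "('n::finite, 'a::comm_ring_1) P"
  assumes "bounded_series h"
  shows "bounded_series (laurent_act p h)"
proof -
  from assms obtain N where N: "\<And>k i. k i < N \<Longrightarrow> h k = 0"
    unfolding bounded_series_def by blast
  define M where "M = (\<Sum>b\<in>Poly_Mapping.keys p. \<Sum>i\<in>UNIV. Poly_Mapping.lookup b i)"
  have M: "Poly_Mapping.lookup b i \<le> M" if "b \<in> Poly_Mapping.keys p" for b i
  proof -
    have "Poly_Mapping.lookup b i \<le> (\<Sum>i\<in>UNIV. Poly_Mapping.lookup b i)"
      by (rule member_le_sum) auto
    also have "\<dots> \<le> M" unfolding M_def using that by (intro member_le_sum) auto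
    finally show ?thesis .
  qed
  have "laurent_act p h k = 0" if k: "k i < N - int M" for k i
    unfolding laurent_act_def coeff_sum_def
  proof (rule sum.neutral, rule ballI)
    fix b assume "b \<in> Poly_Mapping.keys p"
    then have "k i + int (Poly_Mapping.lookup b i) < N" using M[of b i] k by linarith
    then show "Poly_Mapping.lookup p b * h (\<lambda>i. k i + int (Poly_Mapping.lookup b i)) = 0"
      using N[of "\<lambda>i. k i + int (Poly_Mapping.lookup b i)" i] by simp
  qed
  then show ?thesis unfolding bounded_series_def by (intro exI allI impI)
qed

text \<open>Raising \<open>k i\<close> by one multiplies the coefficient by x_i, so the zeros at low
  index propagate upwards.\<close>

lemma laurent_act_zv_eq_0D:
  assumes "bounded_series h" "laurent_act (zv i) h = (\<lambda>_. 0)"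
  shows "h = (\<lambda>_. 0)"
proof
  fix k
  from assms(1) obtain N where N: "\<And>k i. k i < N \<Longrightarrow> h k = 0"
    unfolding bounded_series_def by blast
  have shift: "h (k(i := j + 1)) = xvar i * h (k(i := j))" for j
    using fun_cong[OF assms(2), of "k(i := j)"] by (simp add: laurent_act_zv)
  have "h (k(i := j)) = 0" if "N - 1 \<le> j" for j
    using that
  proof (induction j rule: int_ge_induct)
    case base
    show ?case by (rule N[of _ i]) simp
  next
    case (step j)
    then show ?case by (simp only: shift mult_zero_right)
  qed
  from this[of "k i"] show "h k = 0"
    using N[of k i] by (cases "k i < N") simp_all
qed

lemma laurent_act_zprod_eq_0D:
  fixes h :: "('n::finite \<Rightarrow> int) \<Rightarrow> ('n, 'a::comm_ring_1) S"
  assumes "bounded_series h" "laurent_act zprod h = (\<lambda>_. 0)"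
  shows "h = (\<lambda>_. 0)"
proof -
  have "laurent_act (\<Prod>i\<in>I. zv i) h = (\<lambda>_. 0) \<Longrightarrow> h = (\<lambda>_. 0)" if "finite I" for I
    using that
  proof induction
    case (insert i I)
    then have "laurent_act (zv i) (laurent_act (\<Prod>i\<in>I. zv i) h) = (\<lambda>_. 0)"
      by (simp add: laurent_act_mult)
    then have "laurent_act (\<Prod>i\<in>I. zv i) h = (\<lambda>_. 0)"
      by (rule laurent_act_zv_eq_0D[OF bounded_series_laurent_act[OF assms(1)]])
    with insert show ?case by simp
  qed simp
  then show ?thesis using assms(2) unfolding zprod_def by simp
qed

text \<open>Pairs of an operator on polynomials and its extension to series. The index is the fuel
  consumed by \<^const>\<open>extz\<close>; it exceeds the order by one.\<close>

inductive series_op ::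
  "nat \<Rightarrow> (('n::finite, 'a::comm_ring_1) P \<Rightarrow> ('n, 'a) P)
    \<Rightarrow> ((('n \<Rightarrow> int) \<Rightarrow> ('n, 'a) S) \<Rightarrow> ('n \<Rightarrow> int) \<Rightarrow> ('n, 'a) S) \<Rightarrow> bool" where
  zero: "series_op n (\<lambda>_. 0) (\<lambda>_ _. 0)"
| lift: "diffop n f \<Longrightarrow> series_op (Suc n) (liftop f) (\<lambda>h k. f (h k))"
| add: "series_op n E F \<Longrightarrow> series_op n E' F' \<Longrightarrow>
    series_op n (\<lambda>p. E p + E' p) (\<lambda>h k. F h k + F' h k)"
| mult: "series_op n E F \<Longrightarrow> series_op n (\<lambda>p. q * E p) (\<lambda>h. laurent_act q (F h))"

lemma series_op_sum:
  assumes "\<And>i. i \<in> I \<Longrightarrow> series_op n (E i) (F i)"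
  shows "series_op n (\<lambda>p. \<Sum>i\<in>I. E i p) (\<lambda>h k. \<Sum>i\<in>I. F i h k)"
  using assms
  by (induction I rule: infinite_finite_induct) (auto intro: series_op.zero series_op.add)

lemma series_op_fuel_0: "series_op n E F \<Longrightarrow> n = 0 \<Longrightarrow> F h = (\<lambda>_. 0)"
  by (induction rule: series_op.induct) (auto simp: laurent_act_def)

lemma bounded_series_op: "series_op n E F \<Longrightarrow> bounded_series h \<Longrightarrow> bounded_series (F h)"
proof (induction rule: series_op.induct)
  case (zero n)
  then show ?case by (simp add: bounded_series_def)
next
  case (lift n f)
  then show ?case using bounded_series_map Alin_0 Alin_if_diffop by blast
qed (auto intro: bounded_series_add bounded_series_laurent_act)

section \<open>Commutators of coefficientwise operators\<close>

lemma lookup_liftop: "Alin f \<Longrightarrow> Poly_Mapping.lookup (liftop f p) b = f (Poly_Mapping.lookup p b)"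
  by (simp add: liftop_def Poly_Mapping.map.rep_eq when_def Alin_0)

lemma liftop_add: "Alin f \<Longrightarrow> liftop f (p + q) = liftop f p + liftop f q"
  by (rule poly_mapping_eqI) (simp add: lookup_liftop lookup_add Alin_add)

lemma liftop_single: "Alin f \<Longrightarrow> liftop f (Poly_Mapping.single b c) = Poly_Mapping.single b (f c)"
  by (rule poly_mapping_eqI) (simp add: lookup_liftop lookup_single when_def Alin_0)

lemma liftop_sum: "Alin f \<Longrightarrow> liftop f (\<Sum>i\<in>I. p i) = (\<Sum>i\<in>I. liftop f (p i))"
  by (rule poly_mapping_eqI) (simp add: lookup_liftop lookup_sum Alin_sum)

lemma add_diff_add: "(a + b) - (c + d) = (a - c) + (b - d)" for a b c d :: "'g::ab_group_add"
  by simp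

text \<open>\<open>liftop f\<close> commutes with powers of y, so only the coefficient
  \<open>c\<close> contributes.\<close>

lemma liftop_single_commutator:
  assumes f: "Alin f"
  shows "liftop f (Poly_Mapping.single b c * p) - Poly_Mapping.single b c * liftop f p =
    Poly_Mapping.single b 1 * liftop (\<lambda>t. f (c * t) - c * f t) p"
proof (induction p rule: poly_mapping_induct_single)
  case (single a d)
  have "Alin (\<lambda>t. f (c * t) - c * f t)"
    using f by (intro Alin_fun_diff Alin_mult_left Alin_mult_right)
  then show ?case by (simp add: mult_single liftop_single f single_diff right_diff_distrib)
next
  case (add p q)
  have "Alin (\<lambda>t. f (c * t) - c * f t)"
    using f by (intro Alin_fun_diff Alin_mult_left Alin_mult_right)
  with add show ?case
    by (simp add: distrib_left liftop_add f add_diff_add)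
qed

lemma poly_mapping_eq_sum_single:
  "q = (\<Sum>b\<in>Poly_Mapping.keys q. Poly_Mapping.single b (Poly_Mapping.lookup q b))"
  by (rule poly_mapping_eqI) (simp add: lookup_sum lookup_single when_def in_keys_iff)

lemma liftop_commutator:
  assumes f: "Alin f"
  shows "liftop f (q * p) - q * liftop f p =
    (\<Sum>b\<in>Poly_Mapping.keys q. Poly_Mapping.single b 1 *
      liftop (\<lambda>t. f (Poly_Mapping.lookup q b * t) - Poly_Mapping.lookup q b * f t) p)"
proof -
  let ?q = "\<Sum>b\<in>Poly_Mapping.keys q. Poly_Mapping.single b (Poly_Mapping.lookup q b)"
  have "liftop f (?q * p) - ?q * liftop f p = (\<Sum>b\<in>Poly_Mapping.keys q.
      liftop f (Poly_Mapping.single b (Poly_Mapping.lookup q b) * p)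
      - Poly_Mapping.single b (Poly_Mapping.lookup q b) * liftop f p)"
    by (simp only: sum_distrib_right liftop_sum[OF f] sum_subtractf)
  then show ?thesis
    by (simp only: liftop_single_commutator[OF f] poly_mapping_eq_sum_single[symmetric])
qed

lemma laurent_act_single:
  "laurent_act (Poly_Mapping.single b c) h k = c * h (\<lambda>i. k i + int (Poly_Mapping.lookup b i))"
  by (simp add: laurent_act_def)

text \<open>The same formula as in \<open>liftop_commutator\<close>, so polynomial and series
  commutators match term by term.\<close>

lemma series_commutator:
  assumes f: "Alin f"
  shows "f (laurent_act q h k) - laurent_act q (\<lambda>k. f (h k)) k =
    (\<Sum>b\<in>Poly_Mapping.keys q. laurent_act (Poly_Mapping.single b 1)
      (\<lambda>k. f (Poly_Mapping.lookup q b * h k) - Poly_Mapping.lookup q b * f (h k)) k)"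
  unfolding laurent_act_single
  by (simp add: laurent_act_def coeff_sum_def Alin_sum[OF f] sum_subtractf)

text \<open>The invariant behind the recursion of \<open>extz\<close>: passing to the commutator
  with z consumes one unit of fuel.\<close>

lemma series_op_commz:
  "series_op n E F \<Longrightarrow>
    series_op (n - 1) (commz E) (\<lambda>h k. F (laurent_act zprod h) k - laurent_act zprod (F h) k)"
proof (induction rule: series_op.induct)
  case (zero n)
  then show ?case
    using series_op.zero[of "n - 1"] by (simp add: commz_def laurent_act_def)
next
  case (lift n f)
  then have f: "Alin f" by (rule Alin_if_diffop)
  define g where "g b = (\<lambda>t. f (Poly_Mapping.lookup zprod b * t) - Poly_Mapping.lookup zprod b * f t)" for b
  have "series_op n (liftop (g b)) (\<lambda>h k. g b (h k))" for b
  proof (cases n)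
    \<comment> \<open>An operator of order 0 has zero commutators, as index 0 demands.\<close>
    case 0
    with lift have "g b = (\<lambda>_. 0)" by (auto simp: g_def)
    moreover have "liftop (\<lambda>_. 0) = (\<lambda>_. 0 :: ('a, 'b) P)"
      by (intro ext poly_mapping_eqI) (simp add: lookup_liftop Alin_zero)
    ultimately show ?thesis by (simp add: series_op.zero)
  next
    case (Suc m)
    with lift have "diffop m (g b)" by (auto simp: g_def)
    then show ?thesis unfolding Suc by (rule series_op.lift)
  qed
  then have "series_op n
      (\<lambda>p. \<Sum>b\<in>Poly_Mapping.keys (zprod :: ('a, 'b) P). Poly_Mapping.single b 1 * liftop (g b) p)
      (\<lambda>h k. \<Sum>b\<in>Poly_Mapping.keys (zprod :: ('a, 'b) P).
        laurent_act (Poly_Mapping.single b 1) (\<lambda>k. g b (h k)) k)"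
    by (intro series_op_sum series_op.mult)
  then show ?case
    by (simp add: commz_def g_def liftop_commutator[OF f] series_commutator[OF f])
next
  case (add n E F E' F')
  have "commz (\<lambda>p. E p + E' p) = (\<lambda>p. commz E p + commz E' p)"
    by (simp add: commz_def fun_eq_iff algebra_simps)
  with series_op.add[OF add(3,4)] show ?case
    by (simp add: laurent_act_fun_add add_diff_add)
next
  case (mult n E F q)
  have "commz (\<lambda>p. q * E p) = (\<lambda>p. q * commz E p)"
    by (simp add: commz_def fun_eq_iff right_diff_distrib mult.left_commute)
  moreover have "laurent_act zprod (laurent_act q (F h)) = laurent_act q (laurent_act zprod (F h))" for h
    by (simp add: laurent_act_mult[symmetric] mult.commute)
  moreover have "laurent_act q (\<lambda>k. h k - g k) = (\<lambda>k. laurent_act q h k - laurent_act q g k)" for h g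
    by (rule ext) (rule laurent_act_fun_diff)
  ultimately show ?case
    using series_op.mult[OF mult(2), of q] by simp
qed

text \<open>Operators are in general only \<open>A\<close>-linear. Entries 0 and 1 still let them
  pass the series of the constant 1 in \<open>series_op_polynomial\<close>.\<close>

lemma inv_series_0_cases:
  "inv_series (\<lambda>_. 0) k \<in> {0, 1 :: ('n::finite, 'a::comm_ring_1) S}"
proof (cases "\<forall>i. k i = - 1")
  case True
  then show ?thesis by (simp add: inv_series_def inv_power_coeff_def)
next
  case False
  then obtain i where i: "k i \<noteq> - 1" by blast
  have "inv_series (\<lambda>_. 0) k = (0 :: ('n, 'a) S)"
    unfolding inv_series_def
    by (rule prod_zero, simp, rule bexI[of _ i]) (use i in \<open>auto simp: inv_power_coeff_def\<close>)
  then show ?thesis by simp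
qed

text \<open>The recursion of \<open>extz\<close> starts at denominator 1, where a polynomial is its
  own expansion.\<close>

lemma series_op_polynomial:
  fixes p :: "('n::finite, 'a::comm_ring_1) P"
  shows "series_op n E F \<Longrightarrow>
    laurent_act (E p) (inv_series (\<lambda>_. 0)) = F (laurent_act p (inv_series (\<lambda>_. 0)))"
proof (induction rule: series_op.induct)
  case (zero n)
  then show ?case by (simp add: fun_eq_iff)
next
  case (lift n f)
  then have f: "Alin f" by (rule Alin_if_diffop)
  show ?case
  proof
    fix k
    show "laurent_act (liftop f p) (inv_series (\<lambda>_. 0)) k = f (laurent_act p (inv_series (\<lambda>_. 0)) k)"
    proof (induction p rule: poly_mapping_induct_single)
      case (single b c)
      show ?case
        using inv_series_0_cases[of "\<lambda>i. k i + int (Poly_Mapping.lookup b i)", where ?'a = 'a]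
        by (auto simp: liftop_single[OF f] laurent_act_single Alin_0[OF f])
    next
      case (add p q)
      then show ?case by (simp add: liftop_add[OF f] laurent_act_add Alin_add[OF f])
    qed
  qed
next
  case (add n E F E' F')
  then show ?case by (simp add: fun_eq_iff laurent_act_add)
next
  case (mult n E F q)
  then show ?case by (simp add: laurent_act_mult)
qed

text \<open>In the recursive case both sides agree after multiplication by z, which is injective on
  bounded series.\<close>

lemma laurent_act_extz:
  fixes E :: "('n::finite, 'a::comm_ring_1) P \<Rightarrow> ('n, 'a) P"
  assumes "series_op n E F"
  shows "laurent_act (fst (extz n E r m)) (inv_series (\<lambda>_. snd (extz n E r m))) =
    F (laurent_act r (inv_series (\<lambda>_. m)))"
  using assms
proof (induction n E r m arbitrary: F rule: extz.induct)
  case (1 E r m)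
  then show ?case using series_op_fuel_0[of 0 E F] by (simp add: fun_eq_iff)
next
  case (2 n E r)
  then show ?case by (simp add: series_op_polynomial)
next
  case (3 n E r m)
  let ?inv = "\<lambda>m. inv_series (\<lambda>_::'n. m) :: _ \<Rightarrow> ('n, 'a) S"
  let ?z = "zprod :: ('n, 'a) P"
  define u v where "u = extz (Suc n) E r m" and "v = extz n (commz E) r (Suc m)"
  have zinv: "laurent_act (?z ^ l) (?inv (k + l)) = ?inv k" for k l
    by (rule laurent_act_zprod_power_inv_series)
  have z1: "laurent_act ?z (?inv (Suc k)) = ?inv k" for k
    using zinv[of 1 k] by simp
  have comm: "laurent_act ?z (laurent_act q h) = laurent_act q (laurent_act ?z h)" for q h
    by (simp add: laurent_act_mult[symmetric] mult.commute)
  \<comment> \<open>\<open>?w\<close> expands r / z^(m + 1), and z times it expands r / z^m, the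
    fraction in the first recursive call.\<close>
  let ?w = "laurent_act r (?inv (Suc m))"
  have u: "laurent_act (fst u) (?inv (snd u)) = F (laurent_act ?z ?w)"
    unfolding u_def comm z1 by (rule 3(1)[OF 3(3)])
  have v: "laurent_act (fst v) (?inv (snd v)) = (\<lambda>k. F (laurent_act ?z ?w) k - laurent_act ?z (F ?w) k)"
    unfolding v_def using 3(2)[OF series_op_commz[OF 3(3), simplified]] .
  define h where "h = (\<lambda>k. laurent_act (fst u) (?inv (Suc (snd u))) k - laurent_act (fst v) (?inv (Suc (snd v))) k)"
  have "laurent_act (fst u * ?z ^ snd v - fst v * ?z ^ snd u) (?inv (Suc (snd u + snd v))) = h"
    using zinv[of "snd v" "Suc (snd u)"] zinv[of "snd u" "Suc (snd v)"]
    by (intro ext) (simp add: h_def laurent_act_diff laurent_act_mult add.commute)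
  then have ext: "laurent_act (fst (extz (Suc n) E r (Suc m))) (?inv (snd (extz (Suc n) E r (Suc m)))) = h"
    by (simp add: fdivz_def fsub_def u_def v_def)
  \<comment> \<open>Multiplication by z undoes \<open>fdivz\<close>, and F(z w) - (F(z w) - z F(w))
    collapses to z F(w).\<close>
  have "laurent_act ?z h = laurent_act ?z (F ?w)"
    unfolding h_def laurent_act_fun_diff[abs_def] comm z1 u v by simp
  then have "laurent_act ?z (\<lambda>k. h k - F ?w k) = (\<lambda>_. 0)"
    by (simp add: fun_eq_iff laurent_act_fun_diff)
  moreover have "bounded_series (\<lambda>k. h k - F ?w k)"
    unfolding h_def
    by (intro bounded_series_diff bounded_series_laurent_act bounded_series_inv_series
        bounded_series_op[OF 3(3)])
  ultimately have "(\<lambda>k. h k - F ?w k) = (\<lambda>_. 0)"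
    by (metis laurent_act_zprod_eq_0D)
  then have "h = F ?w" by (simp add: fun_eq_iff)
  with ext show ?case by simp
qed

text \<open>The operator acts on every coefficient of the expansion, and the values of
  \<open>Theta\<close> on monomials are such coefficients. The fuel in \<open>dact\<close> is the
  index given by the rule \<open>lift\<close>.\<close>

lemma Theta_dact:
  assumes "f \<in> Dops"
  shows "Theta (dact f u) = f \<circ> Theta u"
proof -
  have d: "diffop (dord f) f"
    using assms unfolding Dops_def dord_def by (auto intro: LeastI_ex)
  show ?thesis
  proof (rule Alin_eqI)
    fix b
    show "Theta (dact f u) (Smonom b) = (f \<circ> Theta u) (Smonom b)"
      unfolding Theta_Smonom o_apply dact_def
      using laurent_act_extz[OF series_op.lift[OF d], of "fst u" "snd u"] by simp
  qed (intro Alin_Theta Alin_comp Alin_if_diffop[OF d])+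
qed

section \<open>Well-definedness, bijectivity and compatibility with differential operators\<close>

theorem theorem3p8:
  shows "(\<forall>u v :: ('n::finite, 'a::comm_ring_1) P \<times> nat. Heq u v \<longrightarrow> Theta u = Theta v)
    \<and> (\<forall>u v :: ('n, 'a) P \<times> nat. Theta u = Theta v \<longrightarrow> Heq u v)
    \<and> (\<forall>u :: ('n, 'a) P \<times> nat. Theta u \<in> Dops)
    \<and> (\<forall>f \<in> (Dops :: (('n, 'a) S \<Rightarrow> ('n, 'a) S) set). \<exists>u. Theta u = f)
    \<and> (\<forall>f \<in> (Dops :: (('n, 'a) S \<Rightarrow> ('n, 'a) S) set). \<forall>u. Theta (dact f u) = f \<circ> Theta u)"
proof (intro conjI allI ballI impI)
  fix u v :: "('n, 'a) P \<times> nat"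
  assume "Heq u v"
  then have "Theta (fsub u v) = (\<lambda>_. 0)"
    unfolding Heq_def by (rule Theta_eq_0_if_cech_zero)
  then show "Theta u = Theta v"
    by (simp add: Theta_fsub fun_eq_iff)
next
  fix u v :: "('n, 'a) P \<times> nat"
  assume "Theta u = Theta v"
  then have "Theta (fsub u v) = (\<lambda>_. 0)"
    by (simp add: Theta_fsub)
  then show "Heq u v"
    unfolding Heq_def by (rule cech_zero_if_Theta_eq_0)
next
  fix f :: "('n, 'a) S \<Rightarrow> ('n, 'a) S"
  assume "f \<in> Dops"
  then obtain n where "diffop n f" by (auto simp: Dops_def)
  then obtain u where "Theta u = f" by (rule obtain_Theta_eq)
  then show "\<exists>u. Theta u = f" ..
qed (rule Theta_in_Dops | erule Theta_dact)+

end
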